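(* Let $\mathcal C$ be an additive category with an additive endofunctor $F:\mathcal C\to\mathcal C$. Suppose that $M$ is a nonzero object of $\mathcal C$ with a decomposition $$M=M_1\oplus\cdots\oplus M_r$$ such that the following hold: (i) for all $d\ge 0$ and all $j,\ell\in\{1,\dots,r\}$, every nonzero morphism $f:F^d(M_j)\to M_\ell$ is an epimorphism; (ii) for all $e\ge0$ and all $j,\ell\in\{1,\dots,r\}$, if $g:F^e(M_j)\to M_\ell$ is an epimorphism, then so is $F^d(g)$ for any $d\ge 0$. Then the orbital ring $O(F,M)$ is a piecewise domain with respect to the idempotents in $\operatorname{End}_{\mathcal C}(M)=O(F,M)_0$ corresponding to the decomposition $M=M_1\oplus\cdots\oplus M_r$. Furthermore, suppose that (i) and (ii) hold along with: (iii) for all $j\ne\ell$ in $\{1,\dots,r\}$, there exists a nonzero morphism $h:F^i(M_j)\to M_\ell$ for some $i\ge0$. Then $O(F,M)$ is prime.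
   Context: Orbital ring: for an object $M$ of an additive category $\mathcal C$ and an additive endofunctor $F$ of $\mathcal C$, the orbital ring is the $\mathbb N$-graded ring $$O(F,M)=\bigoplus_{i=0}^\infty\operatorname{Hom}_{\mathcal C}(F^iM,M),$$ with multiplication defined on homogeneous elements $f\in\operatorname{Hom}_{\mathcal C}(F^iM,M)$ and $g\in\operatorname{Hom}_{\mathcal C}(F^jM,M)$ by $f*g=f\circ F^i(g)\in\operatorname{Hom}_{\mathcal C}(F^{i+j}M,M)$. The idempotent $e_i\in\operatorname{End}_{\mathcal C}(M)$ corresponding to $M_i$ is the composite $M\to M_i\to M$ of the projection and the inclusion given by the decomposition. Piecewise domain: a ring $R$ with pairwise orthogonal idempotents $\{e_i\}$ such that $1=\sum_{i=1}^r e_i$ is a piecewise domain with respect to $\{e_i\}$ if for all $i,j,\ell$: $x\in e_iRe_j$, $y\in e_jRe_\ell$ and $xy=0$ imply $x=0$ or $y=0$. *)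

theory Defs
  imports "HOL-Algebra.Product_Groups" "HOL-Algebra.Ideal_Product"
begin

text \<open>Composition is written in the usual order and is only meaningful on composable arrows.\<close>

record ('o, 'm) cat =
  Ob :: "'o set"
  Arr :: "'m set"
  Dom :: "'m \<Rightarrow> 'o"
  Cod :: "'m \<Rightarrow> 'o"
  Id :: "'o \<Rightarrow> 'm"
  Comp :: "'m \<Rightarrow> 'm \<Rightarrow> 'm" (infixl \<open>\<bullet>\<index>\<close> 70)

definition homset :: "('o, 'm, 'x) cat_scheme \<Rightarrow> 'o \<Rightarrow> 'o \<Rightarrow> 'm set" where
  "homset C A B = {f \<in> Arr C. Dom C f = A \<and> Cod C f = B}"

locale category =
  fixes C :: "('o, 'm, 'x) cat_scheme" (structure)
  assumes Dom_Ob: "f \<in> Arr C \<Longrightarrow> Dom C f \<in> Ob C"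
    and Cod_Ob: "f \<in> Arr C \<Longrightarrow> Cod C f \<in> Ob C"
    and Id_homset: "A \<in> Ob C \<Longrightarrow> Id C A \<in> homset C A A"
    and Comp_homset: "\<lbrakk>f \<in> homset C A B; g \<in> homset C B D\<rbrakk> \<Longrightarrow> g \<bullet> f \<in> homset C A D"
    and Comp_assoc: "\<lbrakk>f \<in> homset C A B; g \<in> homset C B D; h \<in> homset C D E\<rbrakk>
                      \<Longrightarrow> (h \<bullet> g) \<bullet> f = h \<bullet> (g \<bullet> f)"
    and Id_left: "f \<in> homset C A B \<Longrightarrow> Id C B \<bullet> f = f"
    and Id_right: "f \<in> homset C A B \<Longrightarrow> f \<bullet> Id C A = f"

definition epimorphism :: "('o, 'm, 'x) cat_scheme \<Rightarrow> 'm \<Rightarrow> bool" where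
  "epimorphism C f \<longleftrightarrow> f \<in> Arr C \<and>
     (\<forall>B. \<forall>g \<in> homset C (Cod C f) B. \<forall>h \<in> homset C (Cod C f) B.
        g \<bullet>\<^bsub>C\<^esub> f = h \<bullet>\<^bsub>C\<^esub> f \<longrightarrow> g = h)"

definition zero_object :: "('o, 'm, 'x) cat_scheme \<Rightarrow> 'o \<Rightarrow> bool" where
  "zero_object C Z \<longleftrightarrow> Z \<in> Ob C \<and>
     (\<forall>A \<in> Ob C. (\<exists>!f. f \<in> homset C Z A) \<and> (\<exists>!f. f \<in> homset C A Z))"

record ('o, 'm) ab_cat = "('o, 'm) cat" +
  Add :: "'m \<Rightarrow> 'm \<Rightarrow> 'm"
  Zero :: "'o \<Rightarrow> 'o \<Rightarrow> 'm"

text \<open>The additive group of morphisms; \<open>mult\<close> is the addition.\<close>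

definition hom_group :: "('o, 'm, 'x) ab_cat_scheme \<Rightarrow> 'o \<Rightarrow> 'o \<Rightarrow> 'm monoid" where
  "hom_group C A B = \<lparr>carrier = homset C A B, mult = Add C, one = Zero C A B\<rparr>"

locale preadditive_category = category C for C :: "('o, 'm, 'x) ab_cat_scheme" (structure) +
  assumes hom_comm_group: "\<lbrakk>A \<in> Ob C; B \<in> Ob C\<rbrakk> \<Longrightarrow> comm_group (hom_group C A B)"
    and Comp_Add_left: "\<lbrakk>f \<in> homset C A B; g \<in> homset C B D; h \<in> homset C B D\<rbrakk>
                      \<Longrightarrow> Add C g h \<bullet> f = Add C (g \<bullet> f) (h \<bullet> f)"
    and Comp_Add_right: "\<lbrakk>f \<in> homset C A B; g \<in> homset C A B; h \<in> homset C B D\<rbrakk>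
                      \<Longrightarrow> h \<bullet> Add C f g = Add C (h \<bullet> f) (h \<bullet> g)"

text \<open>
  \<open>M\<close> is the direct sum (biproduct) of the \<open>X i\<close>, \<open>i \<in> I\<close>, with inclusions \<open>\<iota> i\<close> and projections
  \<open>\<pi> i\<close>; the product over \<open>I\<close> is the sum of the \<open>\<iota> i \<bullet> \<pi> i\<close> in the additive group of endomorphisms.
\<close>

definition is_direct_sum ::
  "('o, 'm, 'x) ab_cat_scheme \<Rightarrow> nat set \<Rightarrow> (nat \<Rightarrow> 'o) \<Rightarrow> 'o \<Rightarrow> (nat \<Rightarrow> 'm) \<Rightarrow> (nat \<Rightarrow> 'm) \<Rightarrow> bool"
  where
  "is_direct_sum C I X M \<iota> \<pi> \<longleftrightarrow>
     finite I \<and> M \<in> Ob C \<and>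
     (\<forall>i \<in> I. X i \<in> Ob C \<and> \<iota> i \<in> homset C (X i) M \<and> \<pi> i \<in> homset C M (X i)) \<and>
     (\<forall>i \<in> I. \<pi> i \<bullet>\<^bsub>C\<^esub> \<iota> i = Id C (X i)) \<and>
     (\<forall>i \<in> I. \<forall>j \<in> I. i \<noteq> j \<longrightarrow> \<pi> j \<bullet>\<^bsub>C\<^esub> \<iota> i = Zero C (X i) (X j)) \<and>
     finprod (hom_group C M M) (\<lambda>i. \<iota> i \<bullet>\<^bsub>C\<^esub> \<pi> i) I = Id C M"

locale additive_category = preadditive_category +
  assumes ex_zero_object: "\<exists>Z. zero_object C Z"
    and ex_binary_direct_sum: "\<lbrakk>A \<in> Ob C; B \<in> Ob C\<rbrakk>
          \<Longrightarrow> \<exists>S \<iota> \<pi>. is_direct_sum C {0, 1} (\<lambda>i. if i = 0 then A else B) S \<iota> \<pi>"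

record ('o, 'm) endofun =
  FOb :: "'o \<Rightarrow> 'o"
  FArr :: "'m \<Rightarrow> 'm"

locale additive_endofunctor = preadditive_category C
  for C :: "('o, 'm, 'x) ab_cat_scheme" (structure) and F :: "('o, 'm) endofun" +
  assumes FOb_Ob: "A \<in> Ob C \<Longrightarrow> FOb F A \<in> Ob C"
    and FArr_homset: "f \<in> homset C A B \<Longrightarrow> FArr F f \<in> homset C (FOb F A) (FOb F B)"
    and FArr_Id: "A \<in> Ob C \<Longrightarrow> FArr F (Id C A) = Id C (FOb F A)"
    and FArr_Comp: "\<lbrakk>f \<in> homset C A B; g \<in> homset C B D\<rbrakk>
                      \<Longrightarrow> FArr F (g \<bullet> f) = FArr F g \<bullet> FArr F f"
    and FArr_Add: "\<lbrakk>f \<in> homset C A B; g \<in> homset C A B\<rbrakk>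
                      \<Longrightarrow> FArr F (Add C f g) = Add C (FArr F f) (FArr F g)"

abbreviation orbital_hom_group ::
  "('o, 'm, 'x) ab_cat_scheme \<Rightarrow> ('o, 'm) endofun \<Rightarrow> 'o \<Rightarrow> nat \<Rightarrow> 'm monoid" where
  "orbital_hom_group C F M i \<equiv> hom_group C ((FOb F ^^ i) M) M"

text \<open>The \<open>d\<close>-th summand inclusion, sending \<open>f\<close> from \<open>F\<^sup>d M\<close> to \<open>M\<close> to a homogeneous element.\<close>

definition homogeneous ::
  "('o, 'm, 'x) ab_cat_scheme \<Rightarrow> ('o, 'm) endofun \<Rightarrow> 'o \<Rightarrow> nat \<Rightarrow> 'm \<Rightarrow> (nat \<Rightarrow> 'm)" where
  "homogeneous C F M d f = (\<lambda>n. if n = d then f else Zero C ((FOb F ^^ n) M) M)"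

text \<open>
  Elements are finitely supported families \<open>x\<close> with \<open>x i\<close> a morphism from \<open>F\<^sup>i M\<close> to \<open>M\<close>; the
  multiplication is the biadditive extension of \<open>f * g = f \<bullet> F\<^sup>i g\<close>, for \<open>f\<close> of degree \<open>i\<close>.
\<close>

definition orbital_ring ::
  "('o, 'm, 'x) ab_cat_scheme \<Rightarrow> ('o, 'm) endofun \<Rightarrow> 'o \<Rightarrow> (nat \<Rightarrow> 'm) ring" where
  "orbital_ring C F M =
     (let G = sum_group UNIV (orbital_hom_group C F M) in
      \<lparr>carrier = carrier G,
       mult = (\<lambda>x y n. finprod (orbital_hom_group C F M n)
                          (\<lambda>i. x i \<bullet>\<^bsub>C\<^esub> (FArr F ^^ i) (y (n - i))) {..n}),
       one = homogeneous C F M 0 (Id C M),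
       zero = one G,
       add = mult G\<rparr>)"

definition peirce :: "('a, 'x) ring_scheme \<Rightarrow> 'a \<Rightarrow> 'a \<Rightarrow> 'a set" where
  "peirce R e f = {e \<otimes>\<^bsub>R\<^esub> x \<otimes>\<^bsub>R\<^esub> f | x. x \<in> carrier R}"

definition piecewise_domain :: "('a, 'x) ring_scheme \<Rightarrow> nat \<Rightarrow> (nat \<Rightarrow> 'a) \<Rightarrow> bool" where
  "piecewise_domain R r e \<longleftrightarrow>
     ring R \<and>
     (\<forall>i \<in> {1..r}. e i \<in> carrier R \<and> e i \<otimes>\<^bsub>R\<^esub> e i = e i) \<and>
     (\<forall>i \<in> {1..r}. \<forall>j \<in> {1..r}. i \<noteq> j \<longrightarrow> e i \<otimes>\<^bsub>R\<^esub> e j = \<zero>\<^bsub>R\<^esub>) \<and>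
     \<one>\<^bsub>R\<^esub> = finsum R e {1..r} \<and>
     (\<forall>i \<in> {1..r}. \<forall>j \<in> {1..r}. \<forall>l \<in> {1..r}.
        \<forall>x \<in> peirce R (e i) (e j). \<forall>y \<in> peirce R (e j) (e l).
          x \<otimes>\<^bsub>R\<^esub> y = \<zero>\<^bsub>R\<^esub> \<longrightarrow> x = \<zero>\<^bsub>R\<^esub> \<or> y = \<zero>\<^bsub>R\<^esub>)"

text \<open>
  Primeness in the noncommutative sense: a nonzero ring in which the product of two nonzero
  two-sided ideals is nonzero. (\<open>primeideal\<close> is confined to commutative rings.)
\<close>

definition prime_ring :: "('a, 'x) ring_scheme \<Rightarrow> bool" where
  "prime_ring R \<longleftrightarrow>
     ring R \<and> \<one>\<^bsub>R\<^esub> \<noteq> \<zero>\<^bsub>R\<^esub> \<and>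
     (\<forall>I J. ideal I R \<and> ideal J R \<and> I \<cdot>\<^bsub>R\<^esub> J = {\<zero>\<^bsub>R\<^esub>} \<longrightarrow> I = {\<zero>\<^bsub>R\<^esub>} \<or> J = {\<zero>\<^bsub>R\<^esub>})"

end

theory Submission
  imports Defs
begin

text \<open>
  Cut a morphism \<open>f\<close> from \<open>F\<^sup>d M\<close> to \<open>M\<close> into its matrix entries, the morphisms from \<open>F\<^sup>d (X j)\<close> to \<open>X i\<close>.
  A homogeneous element that is fixed by the idempotent of \<open>X i\<close> on the left and by that of \<open>X j\<close> on the right has only one
  entry, and is recovered from it (\<open>uncorner_corner\<close>). If \<open>f'\<close> and \<open>g'\<close> are the entries of two such
  elements \<open>f\<close>, \<open>g\<close> with matching middle index, of degrees \<open>m\<close> and \<open>n\<close>, then \<open>f'\<close> composed with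
  \<open>F\<^sup>m g'\<close> is the entry of \<open>f * g\<close> (\<open>corner_Comp\<close>). If \<open>g'\<close> is nonzero, it is an epimorphism by the first
  hypothesis, hence so is \<open>F\<^sup>m g'\<close> by the second, and an epimorphism cancels on the right: if
  \<open>f * g = 0\<close> then \<open>f' = 0\<close>, so \<open>f = 0\<close>.

  For inhomogeneous elements of the Peirce corners the argument applies to their components of top
  degree, because the top component of a product is the product of the top components
  (\<open>mult_top\<close>) and because a corner for idempotents of degree zero is a graded subgroup
  (\<open>peirce_in_degree_iff\<close>). This reduction and the ring axioms use only that
  \<open>(f, g) \<mapsto> f \<bullet> F\<^sup>i g\<close> is a biadditive, associative, unital and degree-additive operation on a
  family of abelian groups. It is therefore proved for all such operations (locale
  \<open>graded_mult\<close>).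

  Primeness is a fact about nonzero piecewise domains in which every corner \<open>e\<^sub>j R e\<^sub>l\<close> with
  \<open>j \<noteq> l\<close> is nonzero
  (\<open>prime_ring_if_piecewise_domain\<close>). Nonzero ideals \<open>I\<close> and \<open>J\<close> contain nonzero elements \<open>x\<close> of
  some \<open>e\<^sub>i R e\<^sub>j\<close> and \<open>y\<close> of some \<open>e\<^sub>k R e\<^sub>l\<close>. With a nonzero \<open>h\<close> in \<open>e\<^sub>j R e\<^sub>k\<close> to link them, \<open>x h y\<close> is a nonzero
  element of \<open>I J\<close>. The third hypothesis supplies the links for \<open>j \<noteq> k\<close>; for \<open>j = k\<close> the
  idempotent is one. The ring is nonzero because \<open>M\<close> is.
\<close>

section \<open>Convolution rings of graded multiplications\<close>

text \<open>The exchange of summation order behind the associativity of a convolution: both sides run over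
  the pairs \<open>(i, j)\<close> with \<open>i + j \<le> n\<close>, on the left grouped by \<open>k = i + j\<close>.\<close>

lemma (in comm_monoid) finprod_triangle:
  assumes "\<And>i j. a i j \<in> carrier G"
  shows "(\<Otimes>k\<in>{..n::nat}. \<Otimes>i\<in>{..k}. a i (k - i)) = (\<Otimes>i\<in>{..n}. \<Otimes>j\<in>{..n - i}. a i j)"
proof (induction n)
  case 0
  then show ?case using assms by (simp add: Pi_def)
next
  case (Suc n)
  let ?diag = "\<Otimes>i\<in>{..n}. a i (Suc n - i)"
  have "(\<Otimes>i\<in>{..n}. \<Otimes>j\<in>{..Suc n - i}. a i j)
      = (\<Otimes>i\<in>{..n}. a i (Suc n - i) \<otimes> (\<Otimes>j\<in>{..n - i}. a i j))"
    using assms by (intro finprod_cong') (auto simp: Suc_diff_le Pi_def)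
  also have "\<dots> = ?diag \<otimes> (\<Otimes>i\<in>{..n}. \<Otimes>j\<in>{..n - i}. a i j)"
    using assms by (subst finprod_multf) (auto simp: Pi_def)
  finally show ?case
    using assms Suc by (simp add: Pi_def m_assoc)
qed

lemma (in comm_monoid) finprod_single_term:
  assumes "finite A" "a \<in> A" "f a \<in> carrier G" "\<And>x. x \<in> A \<Longrightarrow> x \<noteq> a \<Longrightarrow> f x = \<one>"
  shows "finprod G f A = f a"
proof -
  have "finprod G f A = (\<Otimes>x\<in>A. if a = x then f x else \<one>)"
  proof (rule finprod_cong')
    show "f x = (if a = x then f x else \<one>)" if "x \<in> A" for x
      using assms(4)[OF that] by auto
    show "(\<lambda>x. if a = x then f x else \<one>) \<in> A \<rightarrow> carrier G"
      using assms(3) by auto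
  qed simp
  also have "\<dots> = f a"
  proof (rule finprod_singleton[OF assms(2,1)])
    show "f \<in> A \<rightarrow> carrier G"
    proof
      show "f x \<in> carrier G" if "x \<in> A" for x
        using assms(3) assms(4)[OF that] by (cases "x = a") auto
    qed
  qed
  finally show ?thesis .
qed

lemma hom_finprod:
  assumes "comm_group G" "comm_group H" "h \<in> hom G H" "finite A" "f \<in> A \<rightarrow> carrier G"
  shows "h (finprod G f A) = finprod H (\<lambda>x. h (f x)) A"
proof -
  interpret G: comm_group G by fact
  interpret H: comm_group H by fact
  have one: "h \<one>\<^bsub>G\<^esub> = \<one>\<^bsub>H\<^esub>"
    using assms(3) by (intro hom_one) auto
  show ?thesis
    using assms(4,5)
  proof (induction A rule: finite_induct)
    case (insert x A)
    moreover have "(\<lambda>x. h (f x)) \<in> insert x A \<rightarrow> carrier H"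
      using insert.prems assms(3) by (auto simp: hom_def Pi_def)
    ultimately show ?case
      using assms(3) by (simp add: hom_mult Pi_def)
  qed (simp add: one)
qed

definition convolution_ring ::
  "(nat \<Rightarrow> 'a monoid) \<Rightarrow> (nat \<Rightarrow> 'a \<Rightarrow> 'a \<Rightarrow> 'a) \<Rightarrow> 'a \<Rightarrow> (nat \<Rightarrow> 'a) ring" where
  "convolution_ring G p u =
     \<lparr>carrier = carrier (sum_group UNIV G),
      mult = (\<lambda>x y n. finprod (G n) (\<lambda>i. p i (x i) (y (n - i))) {..n}),
      one = (\<lambda>n. if n = 0 then u else \<one>\<^bsub>G n\<^esub>),
      zero = \<one>\<^bsub>sum_group UNIV G\<^esub>,
      add = mult (sum_group UNIV G)\<rparr>"

text \<open>The axioms of a graded ring, with the multiplication given on homogeneous elements: \<open>p i x y\<close> is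
  the product of \<open>x\<close>, of degree \<open>i\<close>, with \<open>y\<close>. The degree of \<open>y\<close> is not an argument, since in an
  orbital ring the product depends on the degree of the left factor only, through the power of the
  functor. The groups \<open>G n\<close> are abelian and written multiplicatively, so that \<open>\<one>\<^bsub>G n\<^esub>\<close> is the zero
  element of degree \<open>n\<close>.\<close>

locale graded_mult =
  fixes G :: "nat \<Rightarrow> 'a monoid" and p :: "nat \<Rightarrow> 'a \<Rightarrow> 'a \<Rightarrow> 'a" and u :: 'a
  assumes comm_group_G: "comm_group (G n)"
    and p_closed: "\<lbrakk>x \<in> carrier (G i); y \<in> carrier (G j)\<rbrakk> \<Longrightarrow> p i x y \<in> carrier (G (i + j))"
    and p_add_left: "\<lbrakk>x \<in> carrier (G i); x' \<in> carrier (G i); y \<in> carrier (G j)\<rbrakk>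
        \<Longrightarrow> p i (x \<otimes>\<^bsub>G i\<^esub> x') y = p i x y \<otimes>\<^bsub>G (i + j)\<^esub> p i x' y"
    and p_add_right: "\<lbrakk>x \<in> carrier (G i); y \<in> carrier (G j); y' \<in> carrier (G j)\<rbrakk>
        \<Longrightarrow> p i x (y \<otimes>\<^bsub>G j\<^esub> y') = p i x y \<otimes>\<^bsub>G (i + j)\<^esub> p i x y'"
    and p_assoc: "\<lbrakk>x \<in> carrier (G i); y \<in> carrier (G j); z \<in> carrier (G k)\<rbrakk>
        \<Longrightarrow> p (i + j) (p i x y) z = p i x (p j y z)"
    and u_closed: "u \<in> carrier (G 0)"
    and u_left: "x \<in> carrier (G i) \<Longrightarrow> p 0 u x = x"
    and u_right: "x \<in> carrier (G i) \<Longrightarrow> p i x u = x"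
begin

sublocale G: comm_group "G n" for n
  by (rule comm_group_G)

abbreviation R where "R \<equiv> convolution_ring G p u"

definition in_degree :: "nat \<Rightarrow> 'a \<Rightarrow> nat \<Rightarrow> 'a" where
  "in_degree d f = (\<lambda>n. if n = d then f else \<one>\<^bsub>G n\<^esub>)"

lemma p_hom_left: "y \<in> carrier (G j) \<Longrightarrow> (\<lambda>x. p i x y) \<in> hom (G i) (G (i + j))"
  by (auto simp: hom_def p_closed p_add_left)

lemma p_hom_right: "x \<in> carrier (G i) \<Longrightarrow> p i x \<in> hom (G j) (G (i + j))"
  by (auto simp: hom_def p_closed p_add_right)

lemma p_zero_left: "y \<in> carrier (G j) \<Longrightarrow> p i \<one>\<^bsub>G i\<^esub> y = \<one>\<^bsub>G (i + j)\<^esub>"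
  by (rule hom_one[OF p_hom_left]) auto

lemma p_zero_right: "x \<in> carrier (G i) \<Longrightarrow> p i x \<one>\<^bsub>G j\<^esub> = \<one>\<^bsub>G (i + j)\<^esub>"
  by (rule hom_one[OF p_hom_right]) auto

lemma carrier_iff_finite:
  "x \<in> carrier R \<longleftrightarrow> (\<forall>n. x n \<in> carrier (G n)) \<and> finite {n. x n \<noteq> \<one>\<^bsub>G n\<^esub>}"
  by (simp add: convolution_ring_def carrier_sum_group PiE_iff)

lemma carrier_iff:
  "x \<in> carrier R \<longleftrightarrow> (\<forall>n. x n \<in> carrier (G n)) \<and> (\<exists>d. \<forall>n>d. x n = \<one>\<^bsub>G n\<^esub>)"
proof -
  have "finite {n. x n \<noteq> \<one>\<^bsub>G n\<^esub>} \<longleftrightarrow> (\<exists>d. \<forall>n>d. x n = \<one>\<^bsub>G n\<^esub>)"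
    by (auto simp: finite_nat_set_iff_bounded_le) (meson not_le)+
  then show ?thesis by (simp add: carrier_iff_finite)
qed

lemma component_closed: "x \<in> carrier R \<Longrightarrow> x n \<in> carrier (G n)"
  by (simp add: carrier_iff)

lemma add_eq: "x \<oplus>\<^bsub>R\<^esub> y = (\<lambda>n. x n \<otimes>\<^bsub>G n\<^esub> y n)"
  by (simp add: convolution_ring_def restrict_UNIV)

lemma zero_eq: "\<zero>\<^bsub>R\<^esub> = (\<lambda>n. \<one>\<^bsub>G n\<^esub>)"
  by (simp add: convolution_ring_def restrict_UNIV)

lemma one_eq: "\<one>\<^bsub>R\<^esub> = in_degree 0 u"
  by (simp add: convolution_ring_def in_degree_def)

lemma mult_eq: "x \<otimes>\<^bsub>R\<^esub> y = (\<lambda>n. finprod (G n) (\<lambda>i. p i (x i) (y (n - i))) {..n})"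
  by (simp add: convolution_ring_def)

lemma in_degree_closed: "f \<in> carrier (G d) \<Longrightarrow> in_degree d f \<in> carrier R"
  by (auto simp: carrier_iff in_degree_def)

lemma in_degree_eq_zero_iff: "in_degree d f = \<zero>\<^bsub>R\<^esub> \<longleftrightarrow> f = \<one>\<^bsub>G d\<^esub>"
  by (auto simp: in_degree_def zero_eq fun_eq_iff)

lemma p_component_closed:
  "\<lbrakk>x i \<in> carrier (G i); y (n - i) \<in> carrier (G (n - i)); i \<le> n\<rbrakk>
   \<Longrightarrow> p i (x i) (y (n - i)) \<in> carrier (G n)"
  using p_closed[of "x i" i "y (n - i)" "n - i"] by simp

lemma mult_component_closed:
  "\<lbrakk>x \<in> carrier R; y \<in> carrier R\<rbrakk> \<Longrightarrow> (x \<otimes>\<^bsub>R\<^esub> y) n \<in> carrier (G n)"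
  unfolding mult_eq by (intro G.finprod_closed Pi_I p_component_closed) (auto simp: component_closed)

lemma mult_above:
  assumes "x \<in> carrier R" "y \<in> carrier R"
    and "\<And>k. k > m \<Longrightarrow> x k = \<one>\<^bsub>G k\<^esub>" "\<And>k. k > n \<Longrightarrow> y k = \<one>\<^bsub>G k\<^esub>" "k > m + n"
  shows "(x \<otimes>\<^bsub>R\<^esub> y) k = \<one>\<^bsub>G k\<^esub>"
  unfolding mult_eq
proof (rule G.finprod_one_eqI)
  fix i assume i: "i \<in> {..k}"
  then have k: "i + (k - i) = k" by simp
  show "p i (x i) (y (k - i)) = \<one>\<^bsub>G k\<^esub>"
  proof (cases "i > m")
    case True
    then show ?thesis
      using assms p_zero_left[of "y (k - i)" "k - i" i] k by (simp add: component_closed)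
  next
    case False
    with assms(5) have "k - i > n" by simp
    then show ?thesis
      using assms p_zero_right[of "x i" i "k - i"] k by (simp add: component_closed)
  qed
qed

text \<open>In degree \<open>m + n\<close> every term of the convolution except that of \<open>i = m\<close> has a factor above the
  top degree: \<open>i > m\<close> on the left, or \<open>m + n - i > n\<close> on the right.\<close>

lemma mult_top:
  assumes "x \<in> carrier R" "y \<in> carrier R"
    and "\<And>k. k > m \<Longrightarrow> x k = \<one>\<^bsub>G k\<^esub>" "\<And>k. k > n \<Longrightarrow> y k = \<one>\<^bsub>G k\<^esub>"
  shows "(x \<otimes>\<^bsub>R\<^esub> y) (m + n) = p m (x m) (y n)"
proof -
  have "finprod (G (m + n)) (\<lambda>i. p i (x i) (y (m + n - i))) {..m + n} = p m (x m) (y (m + n - m))"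
  proof (rule G.finprod_single_term)
    fix i assume i: "i \<in> {..m + n}" "i \<noteq> m"
    then have k: "i + (m + n - i) = m + n" by simp
    show "p i (x i) (y (m + n - i)) = \<one>\<^bsub>G (m + n)\<^esub>"
    proof (cases "i > m")
      case True
      then show ?thesis
        using assms p_zero_left[of "y (m + n - i)" "m + n - i" i] k by (simp add: component_closed)
    next
      case False
      with i have "m + n - i > n" by simp
      then show ?thesis
        using assms p_zero_right[of "x i" i "m + n - i"] k by (simp add: component_closed)
    qed
  qed (use assms in \<open>auto simp: p_closed component_closed\<close>)
  then show ?thesis by (simp add: mult_eq)
qed

lemma mult_closed:
  assumes "x \<in> carrier R" "y \<in> carrier R"
  shows "x \<otimes>\<^bsub>R\<^esub> y \<in> carrier R"
proof -
  obtain m n where "\<forall>k>m. x k = \<one>\<^bsub>G k\<^esub>" "\<forall>k>n. y k = \<one>\<^bsub>G k\<^esub>"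
    using assms by (auto simp: carrier_iff)
  with assms have "\<forall>k>m + n. (x \<otimes>\<^bsub>R\<^esub> y) k = \<one>\<^bsub>G k\<^esub>"
    using mult_above[of x y m n] by blast
  with assms show ?thesis
    using mult_component_closed unfolding carrier_iff by blast
qed

lemma in_degree_0_mult:
  assumes "f \<in> carrier (G 0)" "x \<in> carrier R"
  shows "in_degree 0 f \<otimes>\<^bsub>R\<^esub> x = (\<lambda>n. p 0 f (x n))"
proof
  fix n
  have "finprod (G n) (\<lambda>i. p i (in_degree 0 f i) (x (n - i))) {..n} = p 0 (in_degree 0 f 0) (x (n - 0))"
  proof (rule G.finprod_single_term)
    show "p 0 (in_degree 0 f 0) (x (n - 0)) \<in> carrier (G n)"
      using assms p_closed[of f 0 "x n" n] by (simp add: in_degree_def component_closed)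
    show "p i (in_degree 0 f i) (x (n - i)) = \<one>\<^bsub>G n\<^esub>" if "i \<in> {..n}" "i \<noteq> 0" for i
      using that assms p_zero_left[of "x (n - i)" "n - i" i] by (simp add: in_degree_def component_closed)
  qed auto
  then show "(in_degree 0 f \<otimes>\<^bsub>R\<^esub> x) n = p 0 f (x n)"
    by (simp add: mult_eq in_degree_def)
qed

lemma mult_in_degree_0:
  assumes "f \<in> carrier (G 0)" "x \<in> carrier R"
  shows "x \<otimes>\<^bsub>R\<^esub> in_degree 0 f = (\<lambda>n. p n (x n) f)"
proof
  fix n
  have "finprod (G n) (\<lambda>i. p i (x i) (in_degree 0 f (n - i))) {..n} = p n (x n) (in_degree 0 f (n - n))"
  proof (rule G.finprod_single_term)
    show "p n (x n) (in_degree 0 f (n - n)) \<in> carrier (G n)"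
      using assms p_closed[of "x n" n f 0] by (simp add: in_degree_def component_closed)
    show "p i (x i) (in_degree 0 f (n - i)) = \<one>\<^bsub>G n\<^esub>" if "i \<in> {..n}" "i \<noteq> n" for i
      using that assms p_zero_right[of "x i" i "n - i"] by (simp add: in_degree_def component_closed)
  qed auto
  then show "(x \<otimes>\<^bsub>R\<^esub> in_degree 0 f) n = p n (x n) f"
    by (simp add: mult_eq in_degree_def)
qed

text \<open>Both bracketings expand to sums of the triple products of \<open>x i\<close>, \<open>y j\<close> and \<open>z (n - i - j)\<close>, the
  left one grouped by \<open>i + j\<close> and the right one by \<open>i\<close>.\<close>

lemma mult_assoc:
  assumes x: "x \<in> carrier R" and y: "y \<in> carrier R" and z: "z \<in> carrier R"
  shows "(x \<otimes>\<^bsub>R\<^esub> y) \<otimes>\<^bsub>R\<^esub> z = x \<otimes>\<^bsub>R\<^esub> (y \<otimes>\<^bsub>R\<^esub> z)"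
proof
  fix n
  note cl = component_closed[OF x] component_closed[OF y] component_closed[OF z]
  \<comment> \<open>Truncated subtraction makes the third index meaningful for \<open>i + j \<le> n\<close> only; elsewhere the
    neutral element keeps the summand inside \<open>G n\<close>.\<close>
  define a where "a i j = (if i + j \<le> n then p i (x i) (p j (y j) (z (n - (i + j)))) else \<one>\<^bsub>G n\<^esub>)" for i j
  have a_closed: "a i j \<in> carrier (G n)" for i j
  proof (cases "i + j \<le> n")
    case True
    then have "i + (j + (n - (i + j))) = n" by simp
    with True show ?thesis
      using p_closed[OF cl(1) p_closed[OF cl(2) cl(3)], of i j "n - (i + j)"] by (simp add: a_def)
  qed (simp add: a_def)
  have left: "p k ((x \<otimes>\<^bsub>R\<^esub> y) k) (z (n - k)) = finprod (G n) (\<lambda>i. a i (k - i)) {..k}" if "k \<le> n" for k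
  proof -
    have "p k (finprod (G k) (\<lambda>i. p i (x i) (y (k - i))) {..k}) (z (n - k))
        = finprod (G n) (\<lambda>i. p k (p i (x i) (y (k - i))) (z (n - k))) {..k}"
      using hom_finprod[OF comm_group_G comm_group_G p_hom_left[OF cl(3)[of "n - k"], of k],
          of "{..k}" "\<lambda>i. p i (x i) (y (k - i))"] that
      by (simp add: Pi_def p_component_closed cl)
    also have "\<dots> = finprod (G n) (\<lambda>i. a i (k - i)) {..k}"
    proof (rule G.finprod_cong')
      fix i assume "i \<in> {..k}"
      then show "p k (p i (x i) (y (k - i))) (z (n - k)) = a i (k - i)"
        using that p_assoc[OF cl, of i "k - i" "n - k"] by (simp add: a_def)
    qed (use that a_closed in auto)
    finally show ?thesis using that by (simp add: mult_eq)
  qed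
  have right: "p i (x i) ((y \<otimes>\<^bsub>R\<^esub> z) (n - i)) = finprod (G n) (\<lambda>j. a i j) {..n - i}" if "i \<le> n" for i
  proof -
    have "p i (x i) (finprod (G (n - i)) (\<lambda>j. p j (y j) (z (n - i - j))) {..n - i})
        = finprod (G n) (\<lambda>j. p i (x i) (p j (y j) (z (n - i - j)))) {..n - i}"
      using hom_finprod[OF comm_group_G comm_group_G p_hom_right[OF cl(1)[of i], of "n - i"],
          of "{..n - i}" "\<lambda>j. p j (y j) (z (n - i - j))"] that cl
      by (simp add: Pi_def p_component_closed del: diff_diff_left)
    also have "\<dots> = finprod (G n) (\<lambda>j. a i j) {..n - i}"
      using that a_closed by (intro G.finprod_cong') (auto simp: a_def)
    finally show ?thesis by (simp add: mult_eq)
  qed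
  have "((x \<otimes>\<^bsub>R\<^esub> y) \<otimes>\<^bsub>R\<^esub> z) n = finprod (G n) (\<lambda>k. p k ((x \<otimes>\<^bsub>R\<^esub> y) k) (z (n - k))) {..n}"
    by (subst mult_eq) simp
  also have "\<dots> = finprod (G n) (\<lambda>k. finprod (G n) (\<lambda>i. a i (k - i)) {..k}) {..n}"
    using a_closed by (intro G.finprod_cong') (auto simp: left)
  also have "\<dots> = finprod (G n) (\<lambda>i. finprod (G n) (\<lambda>j. a i j) {..n - i}) {..n}"
    using a_closed by (rule G.finprod_triangle)
  also have "\<dots> = finprod (G n) (\<lambda>i. p i (x i) ((y \<otimes>\<^bsub>R\<^esub> z) (n - i))) {..n}"
    by (intro G.finprod_cong') (auto simp: right a_closed intro!: G.finprod_closed)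
  also have "\<dots> = (x \<otimes>\<^bsub>R\<^esub> (y \<otimes>\<^bsub>R\<^esub> z)) n"
    by (subst (2) mult_eq) simp
  finally show "((x \<otimes>\<^bsub>R\<^esub> y) \<otimes>\<^bsub>R\<^esub> z) n = (x \<otimes>\<^bsub>R\<^esub> (y \<otimes>\<^bsub>R\<^esub> z)) n" .
qed

lemma ring_R: "ring R"
proof (rule ringI)
  show "abelian_group R"
  proof (rule abelian_groupI)
    fix x y assume x: "x \<in> carrier R" and y: "y \<in> carrier R"
    obtain m n where "\<forall>k>m. x k = \<one>\<^bsub>G k\<^esub>" "\<forall>k>n. y k = \<one>\<^bsub>G k\<^esub>"
      using x y by (auto simp: carrier_iff)
    then have "\<forall>k>m + n. x k \<otimes>\<^bsub>G k\<^esub> y k = \<one>\<^bsub>G k\<^esub>" by simp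
    then show "x \<oplus>\<^bsub>R\<^esub> y \<in> carrier R"
      using x y unfolding carrier_iff add_eq by blast
    show "x \<oplus>\<^bsub>R\<^esub> y = y \<oplus>\<^bsub>R\<^esub> x"
      using x y by (simp add: add_eq G.m_comm component_closed)
  next
    fix x assume x: "x \<in> carrier R"
    then have "(\<lambda>n. inv\<^bsub>G n\<^esub> x n) \<in> carrier R" by (auto simp: carrier_iff)
    moreover have "(\<lambda>n. inv\<^bsub>G n\<^esub> x n) \<oplus>\<^bsub>R\<^esub> x = \<zero>\<^bsub>R\<^esub>"
      using x by (simp add: add_eq zero_eq G.l_inv component_closed)
    ultimately show "\<exists>y\<in>carrier R. y \<oplus>\<^bsub>R\<^esub> x = \<zero>\<^bsub>R\<^esub>" by blast
  qed (auto simp: add_eq zero_eq G.m_assoc carrier_iff)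
  show "monoid R"
    by (rule monoidI)
      (auto simp: one_eq u_closed in_degree_closed mult_closed mult_assoc in_degree_0_mult
        mult_in_degree_0 u_left[OF component_closed] u_right[OF component_closed])
  fix x y z assume xyz: "x \<in> carrier R" "y \<in> carrier R" "z \<in> carrier R"
  show "(x \<oplus>\<^bsub>R\<^esub> y) \<otimes>\<^bsub>R\<^esub> z = x \<otimes>\<^bsub>R\<^esub> z \<oplus>\<^bsub>R\<^esub> y \<otimes>\<^bsub>R\<^esub> z"
  proof
    fix n
    have "finprod (G n) (\<lambda>i. p i (x i \<otimes>\<^bsub>G i\<^esub> y i) (z (n - i))) {..n}
        = finprod (G n) (\<lambda>i. p i (x i) (z (n - i)) \<otimes>\<^bsub>G n\<^esub> p i (y i) (z (n - i))) {..n}"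
    proof (rule G.finprod_cong')
      fix i assume "i \<in> {..n}"
      then show "p i (x i \<otimes>\<^bsub>G i\<^esub> y i) (z (n - i)) = p i (x i) (z (n - i)) \<otimes>\<^bsub>G n\<^esub> p i (y i) (z (n - i))"
        using p_add_left[of "x i" i "y i" "z (n - i)" "n - i"] xyz by (simp add: component_closed)
    qed (use xyz in \<open>auto intro!: p_component_closed simp: component_closed\<close>)
    also have "\<dots> = (x \<otimes>\<^bsub>R\<^esub> z \<oplus>\<^bsub>R\<^esub> y \<otimes>\<^bsub>R\<^esub> z) n"
      using xyz by (auto simp: mult_eq add_eq intro!: G.finprod_multf p_component_closed simp: component_closed)
    finally show "((x \<oplus>\<^bsub>R\<^esub> y) \<otimes>\<^bsub>R\<^esub> z) n = (x \<otimes>\<^bsub>R\<^esub> z \<oplus>\<^bsub>R\<^esub> y \<otimes>\<^bsub>R\<^esub> z) n"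
      by (simp add: mult_eq add_eq)
  qed
  show "z \<otimes>\<^bsub>R\<^esub> (x \<oplus>\<^bsub>R\<^esub> y) = z \<otimes>\<^bsub>R\<^esub> x \<oplus>\<^bsub>R\<^esub> z \<otimes>\<^bsub>R\<^esub> y"
  proof
    fix n
    have "finprod (G n) (\<lambda>i. p i (z i) (x (n - i) \<otimes>\<^bsub>G (n - i)\<^esub> y (n - i))) {..n}
        = finprod (G n) (\<lambda>i. p i (z i) (x (n - i)) \<otimes>\<^bsub>G n\<^esub> p i (z i) (y (n - i))) {..n}"
    proof (rule G.finprod_cong')
      fix i assume "i \<in> {..n}"
      then show "p i (z i) (x (n - i) \<otimes>\<^bsub>G (n - i)\<^esub> y (n - i))
          = p i (z i) (x (n - i)) \<otimes>\<^bsub>G n\<^esub> p i (z i) (y (n - i))"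
        using p_add_right[of "z i" i "x (n - i)" "n - i" "y (n - i)"] xyz by (simp add: component_closed)
    qed (use xyz in \<open>auto intro!: p_component_closed simp: component_closed\<close>)
    also have "\<dots> = (z \<otimes>\<^bsub>R\<^esub> x \<oplus>\<^bsub>R\<^esub> z \<otimes>\<^bsub>R\<^esub> y) n"
      using xyz by (auto simp: mult_eq add_eq intro!: G.finprod_multf p_component_closed simp: component_closed)
    finally show "(z \<otimes>\<^bsub>R\<^esub> (x \<oplus>\<^bsub>R\<^esub> y)) n = (z \<otimes>\<^bsub>R\<^esub> x \<oplus>\<^bsub>R\<^esub> z \<otimes>\<^bsub>R\<^esub> y) n"
      by (simp add: mult_eq add_eq)
  qed
qed

lemma finsum_in_degree:
  assumes "finite A" "\<And>k. k \<in> A \<Longrightarrow> f k \<in> carrier (G d)"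
  shows "finsum R (\<lambda>k. in_degree d (f k)) A = in_degree d (finprod (G d) f A)"
proof -
  interpret R: ring R by (rule ring_R)
  have "in_degree d \<in> hom (G d) (add_monoid R)"
    using in_degree_closed by (auto simp: hom_def in_degree_def add_eq)
  from hom_finprod[OF comm_group_G R.a_comm_group this assms(1), of f] assms(2)
  show ?thesis by (simp add: finsum_def)
qed

text \<open>Multiplication by an element of degree zero acts on each component separately, so membership in
  a Peirce corner can be tested componentwise; this carries a statement about corners of the ring
  over to homogeneous elements.\<close>

lemma peirce_in_degree_iff:
  assumes "f \<in> carrier (G 0)" "p 0 f f = f" "g \<in> carrier (G 0)" "p 0 g g = g"
  shows "x \<in> peirce R (in_degree 0 f) (in_degree 0 g) \<longleftrightarrow>
    x \<in> carrier R \<and> (\<forall>n. p 0 f (x n) = x n \<and> p n (x n) g = x n)"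
proof -
  interpret R: ring R by (rule ring_R)
  note fR = in_degree_closed[OF assms(1)] and gR = in_degree_closed[OF assms(3)]
  show ?thesis
  proof
    assume "x \<in> peirce R (in_degree 0 f) (in_degree 0 g)"
    then obtain a where a: "a \<in> carrier R" "x = in_degree 0 f \<otimes>\<^bsub>R\<^esub> a \<otimes>\<^bsub>R\<^esub> in_degree 0 g"
      by (auto simp: peirce_def)
    then have x: "x \<in> carrier R" using fR gR by simp
    have "in_degree 0 f \<otimes>\<^bsub>R\<^esub> in_degree 0 f = in_degree 0 f" "in_degree 0 g \<otimes>\<^bsub>R\<^esub> in_degree 0 g = in_degree 0 g"
      using assms fR gR by (auto simp: in_degree_0_mult) (auto simp: in_degree_def p_zero_right[of _ 0, simplified])
    then have "in_degree 0 f \<otimes>\<^bsub>R\<^esub> x = x" "x \<otimes>\<^bsub>R\<^esub> in_degree 0 g = x"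
      using a fR gR by (simp_all add: R.m_assoc) (simp flip: R.m_assoc)
    then show "x \<in> carrier R \<and> (\<forall>n. p 0 f (x n) = x n \<and> p n (x n) g = x n)"
      using x assms by (simp add: in_degree_0_mult mult_in_degree_0 fun_eq_iff)
  next
    assume x: "x \<in> carrier R \<and> (\<forall>n. p 0 f (x n) = x n \<and> p n (x n) g = x n)"
    then have "x = in_degree 0 f \<otimes>\<^bsub>R\<^esub> x \<otimes>\<^bsub>R\<^esub> in_degree 0 g"
      using assms by (simp add: in_degree_0_mult mult_in_degree_0)
    with x show "x \<in> peirce R (in_degree 0 f) (in_degree 0 g)"
      by (auto simp: peirce_def)
  qed
qed

lemma top_degree:
  assumes "x \<in> carrier R" "x \<noteq> \<zero>\<^bsub>R\<^esub>"
  obtains d where "x d \<noteq> \<one>\<^bsub>G d\<^esub>" "\<And>k. k > d \<Longrightarrow> x k = \<one>\<^bsub>G k\<^esub>"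
proof -
  let ?S = "{n. x n \<noteq> \<one>\<^bsub>G n\<^esub>}"
  have S: "finite ?S" "?S \<noteq> {}"
    using assms by (auto simp: carrier_iff_finite zero_eq fun_eq_iff)
  show thesis
  proof (rule that)
    show "x (Max ?S) \<noteq> \<one>\<^bsub>G (Max ?S)\<^esub>" using Max_in[OF S] by simp
    show "x k = \<one>\<^bsub>G k\<^esub>" if "k > Max ?S" for k
      using Max_ge[OF S(1), of k] that by (metis (mono_tags, lifting) mem_Collect_eq not_le)
  qed
qed

text \<open>It suffices to exclude zero divisors among homogeneous elements: if \<open>x\<close> and \<open>y\<close> are nonzero,
  their top components are nonzero and lie in the same corners, and the product of these is a
  component of the product of \<open>x\<close> and \<open>y\<close>.\<close>

lemma piecewise_domain_R:
  fixes \<epsilon> :: "nat \<Rightarrow> 'a"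
  assumes closed: "\<And>i. i \<in> {1..r} \<Longrightarrow> \<epsilon> i \<in> carrier (G 0)"
    and idem: "\<And>i. i \<in> {1..r} \<Longrightarrow> p 0 (\<epsilon> i) (\<epsilon> i) = \<epsilon> i"
    and orth: "\<And>i j. \<lbrakk>i \<in> {1..r}; j \<in> {1..r}; i \<noteq> j\<rbrakk> \<Longrightarrow> p 0 (\<epsilon> i) (\<epsilon> j) = \<one>\<^bsub>G 0\<^esub>"
    and sum: "finprod (G 0) \<epsilon> {1..r} = u"
    and dom: "\<And>i j l m n f g. \<lbrakk>i \<in> {1..r}; j \<in> {1..r}; l \<in> {1..r};
        f \<in> carrier (G m); p 0 (\<epsilon> i) f = f; p m f (\<epsilon> j) = f;
        g \<in> carrier (G n); p 0 (\<epsilon> j) g = g; p n g (\<epsilon> l) = g;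
        p m f g = \<one>\<^bsub>G (m + n)\<^esub>\<rbrakk> \<Longrightarrow> f = \<one>\<^bsub>G m\<^esub> \<or> g = \<one>\<^bsub>G n\<^esub>"
  shows "piecewise_domain R r (\<lambda>k. in_degree 0 (\<epsilon> k))"
  unfolding piecewise_domain_def
proof (intro conjI ballI impI)
  interpret R: ring R by (rule ring_R)
  show "ring R" by (rule ring_R)
  have mult: "in_degree 0 (\<epsilon> i) \<otimes>\<^bsub>R\<^esub> in_degree 0 (\<epsilon> j) = in_degree 0 (p 0 (\<epsilon> i) (\<epsilon> j))"
    if "i \<in> {1..r}" "j \<in> {1..r}" for i j
    using closed[OF that(1)] closed[OF that(2)] p_zero_right[of "\<epsilon> i" 0]
    by (auto simp: in_degree_0_mult in_degree_closed) (auto simp: in_degree_def)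
  fix i assume i: "i \<in> {1..r}"
  show "in_degree 0 (\<epsilon> i) \<in> carrier R" by (simp add: in_degree_closed closed[OF i])
  show "in_degree 0 (\<epsilon> i) \<otimes>\<^bsub>R\<^esub> in_degree 0 (\<epsilon> i) = in_degree 0 (\<epsilon> i)"
    using mult[OF i i] idem[OF i] by simp
  fix j assume j: "j \<in> {1..r}"
  show "in_degree 0 (\<epsilon> i) \<otimes>\<^bsub>R\<^esub> in_degree 0 (\<epsilon> j) = \<zero>\<^bsub>R\<^esub>" if "i \<noteq> j"
    using mult[OF i j] orth[OF i j that] by (simp add: in_degree_eq_zero_iff)
  fix l x y
  assume l: "l \<in> {1..r}"
    and x: "x \<in> peirce R (in_degree 0 (\<epsilon> i)) (in_degree 0 (\<epsilon> j))"
    and y: "y \<in> peirce R (in_degree 0 (\<epsilon> j)) (in_degree 0 (\<epsilon> l))"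
    and xy: "x \<otimes>\<^bsub>R\<^esub> y = \<zero>\<^bsub>R\<^esub>"
  have x': "x \<in> carrier R" "p 0 (\<epsilon> i) (x n) = x n" "p n (x n) (\<epsilon> j) = x n" for n
    using x peirce_in_degree_iff closed idem i j by auto
  have y': "y \<in> carrier R" "p 0 (\<epsilon> j) (y n) = y n" "p n (y n) (\<epsilon> l) = y n" for n
    using y peirce_in_degree_iff closed idem j l by auto
  show "x = \<zero>\<^bsub>R\<^esub> \<or> y = \<zero>\<^bsub>R\<^esub>"
  proof (rule ccontr)
    assume "\<not> ?thesis"
    then obtain m n where m: "x m \<noteq> \<one>\<^bsub>G m\<^esub>" "\<And>k. k > m \<Longrightarrow> x k = \<one>\<^bsub>G k\<^esub>"
      and n: "y n \<noteq> \<one>\<^bsub>G n\<^esub>" "\<And>k. k > n \<Longrightarrow> y k = \<one>\<^bsub>G k\<^esub>"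
      using top_degree x'(1) y'(1) by metis
    have "p m (x m) (y n) = \<one>\<^bsub>G (m + n)\<^esub>"
      using mult_top[OF x'(1) y'(1) m(2) n(2)] xy by (simp add: zero_eq)
    with dom[OF i j l component_closed[OF x'(1)] x'(2,3) component_closed[OF y'(1)] y'(2,3)] m n
    show False by blast
  qed
next
  show "\<one>\<^bsub>R\<^esub> = finsum R (\<lambda>k. in_degree 0 (\<epsilon> k)) {1..r}"
    using finsum_in_degree[of "{1..r}" \<epsilon> 0] closed sum by (simp add: one_eq)
qed

end

section \<open>Primeness of piecewise domains\<close>

text \<open>Since the \<open>e i\<close> sum to one, \<open>a\<close> is the sum of its corners \<open>e i \<otimes> a \<otimes> e j\<close>.\<close>

lemma (in ring) exists_nonzero_corner:
  assumes "finite A" "\<And>i. i \<in> A \<Longrightarrow> e i \<in> carrier R" "\<one> = finsum R e A"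
    and a: "a \<in> carrier R" "a \<noteq> \<zero>"
  obtains i j where "i \<in> A" "j \<in> A" "e i \<otimes> a \<otimes> e j \<noteq> \<zero>"
proof -
  have "\<exists>i\<in>A. e i \<otimes> a \<noteq> \<zero>"
  proof (rule ccontr)
    assume "\<not> ?thesis"
    then have "finsum R (\<lambda>i. e i \<otimes> a) A = \<zero>" by (intro add.finprod_one_eqI) auto
    moreover have "a = finsum R (\<lambda>i. e i \<otimes> a) A"
      using finsum_ldistr[of A a e] assms(1,2) a by (simp add: Pi_def flip: assms(3))
    ultimately show False using a by simp
  qed
  then obtain i where i: "i \<in> A" "e i \<otimes> a \<noteq> \<zero>" by blast
  have "\<exists>j\<in>A. e i \<otimes> a \<otimes> e j \<noteq> \<zero>"
  proof (rule ccontr)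
    assume "\<not> ?thesis"
    then have "finsum R (\<lambda>j. e i \<otimes> a \<otimes> e j) A = \<zero>" by (intro add.finprod_one_eqI) auto
    moreover have "e i \<otimes> a = finsum R (\<lambda>j. e i \<otimes> a \<otimes> e j) A"
      using finsum_rdistr[of A "e i \<otimes> a" e] assms(1,2) a i by (simp add: Pi_def flip: assms(3))
    ultimately show False using i by simp
  qed
  with i that show thesis by blast
qed

text \<open>Two nonzero corner elements, one from each ideal, are linked by a nonzero element between them.
  If the indices to be linked coincide, their idempotent \<open>e j\<close> itself is the link: it is nonzero because it
  fixes a nonzero element.\<close>

lemma prime_ring_if_piecewise_domain:
  assumes pd: "piecewise_domain R r e" and "\<one>\<^bsub>R\<^esub> \<noteq> \<zero>\<^bsub>R\<^esub>"
    and nz: "\<And>j l. \<lbrakk>j \<in> {1..r}; l \<in> {1..r}; j \<noteq> l\<rbrakk> \<Longrightarrow> \<exists>h \<in> peirce R (e j) (e l). h \<noteq> \<zero>\<^bsub>R\<^esub>"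
  shows "prime_ring R"
  unfolding prime_ring_def
proof (intro conjI allI impI)
  show "ring R" using pd by (simp add: piecewise_domain_def)
  interpret ring R by fact
  have e: "e i \<in> carrier R" "e i \<otimes>\<^bsub>R\<^esub> e i = e i" if "i \<in> {1..r}" for i
    using pd that by (auto simp: piecewise_domain_def)
  have one: "\<one>\<^bsub>R\<^esub> = finsum R e {1..r}"
    using pd by (simp add: piecewise_domain_def)
  have dom: "x \<otimes>\<^bsub>R\<^esub> y \<noteq> \<zero>\<^bsub>R\<^esub>"
    if "i \<in> {1..r}" "j \<in> {1..r}" "l \<in> {1..r}" "x \<in> peirce R (e i) (e j)" "y \<in> peirce R (e j) (e l)"
      "x \<noteq> \<zero>\<^bsub>R\<^esub>" "y \<noteq> \<zero>\<^bsub>R\<^esub>" for i j l x y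
    using pd that unfolding piecewise_domain_def by blast
  show "\<one>\<^bsub>R\<^esub> \<noteq> \<zero>\<^bsub>R\<^esub>" by fact
  fix I J assume IJ: "ideal I R \<and> ideal J R \<and> I \<cdot>\<^bsub>R\<^esub> J = {\<zero>\<^bsub>R\<^esub>}"
  interpret I: ideal I R using IJ by simp
  interpret J: ideal J R using IJ by simp
  show "I = {\<zero>\<^bsub>R\<^esub>} \<or> J = {\<zero>\<^bsub>R\<^esub>}"
  proof (rule ccontr)
    assume "\<not> ?thesis"
    then obtain a b where a: "a \<in> I" "a \<noteq> \<zero>\<^bsub>R\<^esub>" and b: "b \<in> J" "b \<noteq> \<zero>\<^bsub>R\<^esub>"
      using I.zero_closed J.zero_closed by blast
    note aR = I.a_Hcarr[OF a(1)] and bR = J.a_Hcarr[OF b(1)]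
    obtain i j where ij: "i \<in> {1..r}" "j \<in> {1..r}" "e i \<otimes>\<^bsub>R\<^esub> a \<otimes>\<^bsub>R\<^esub> e j \<noteq> \<zero>\<^bsub>R\<^esub>"
      using exists_nonzero_corner[OF _ e(1) one aR a(2)] by blast
    obtain k l where kl: "k \<in> {1..r}" "l \<in> {1..r}" "e k \<otimes>\<^bsub>R\<^esub> b \<otimes>\<^bsub>R\<^esub> e l \<noteq> \<zero>\<^bsub>R\<^esub>"
      using exists_nonzero_corner[OF _ e(1) one bR b(2)] by blast
    define x where "x = e i \<otimes>\<^bsub>R\<^esub> a \<otimes>\<^bsub>R\<^esub> e j"
    define y where "y = e k \<otimes>\<^bsub>R\<^esub> b \<otimes>\<^bsub>R\<^esub> e l"
    have x: "x \<in> I" "x \<in> peirce R (e i) (e j)" "x \<noteq> \<zero>\<^bsub>R\<^esub>"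
      using ij a aR e I.I_l_closed I.I_r_closed by (auto simp: x_def peirce_def)
    have y: "y \<in> J" "y \<in> peirce R (e k) (e l)" "y \<noteq> \<zero>\<^bsub>R\<^esub>"
      using kl b bR e J.I_l_closed J.I_r_closed by (auto simp: y_def peirce_def)
    have "\<exists>h \<in> peirce R (e j) (e k). h \<noteq> \<zero>\<^bsub>R\<^esub>"
    proof (cases "j = k")
      case True
      have "e j = e j \<otimes>\<^bsub>R\<^esub> \<one>\<^bsub>R\<^esub> \<otimes>\<^bsub>R\<^esub> e j" using e[OF ij(2)] by simp
      then have "e j \<in> peirce R (e j) (e k)" using True by (auto simp: peirce_def)
      moreover have "e j \<noteq> \<zero>\<^bsub>R\<^esub>"
        using ij(3) aR e[OF ij(1)] by auto
      ultimately show ?thesis by blast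
    qed (use nz ij kl in blast)
    then obtain h where h: "h \<in> peirce R (e j) (e k)" "h \<noteq> \<zero>\<^bsub>R\<^esub>" by blast
    have hR: "h \<in> carrier R" using h e[OF ij(2)] e[OF kl(1)] by (auto simp: peirce_def)
    have xh: "x \<otimes>\<^bsub>R\<^esub> h \<noteq> \<zero>\<^bsub>R\<^esub>"
      using dom[OF ij(1,2) kl(1)] x h by blast
    have "x \<otimes>\<^bsub>R\<^esub> h \<in> peirce R (e i) (e k)"
    proof -
      obtain c where c: "c \<in> carrier R" "h = e j \<otimes>\<^bsub>R\<^esub> c \<otimes>\<^bsub>R\<^esub> e k" using h by (auto simp: peirce_def)
      have "x \<otimes>\<^bsub>R\<^esub> h = e i \<otimes>\<^bsub>R\<^esub> (a \<otimes>\<^bsub>R\<^esub> e j \<otimes>\<^bsub>R\<^esub> e j \<otimes>\<^bsub>R\<^esub> c) \<otimes>\<^bsub>R\<^esub> e k"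
        using c aR e(1)[OF ij(1)] e(1)[OF ij(2)] e(1)[OF kl(1)] by (simp add: x_def m_assoc)
      moreover have "a \<otimes>\<^bsub>R\<^esub> e j \<otimes>\<^bsub>R\<^esub> e j \<otimes>\<^bsub>R\<^esub> c \<in> carrier R"
        using c aR e(1)[OF ij(2)] by simp
      ultimately show ?thesis unfolding peirce_def by blast
    qed
    then have "x \<otimes>\<^bsub>R\<^esub> h \<otimes>\<^bsub>R\<^esub> y \<noteq> \<zero>\<^bsub>R\<^esub>"
      using dom[OF ij(1) kl(1,2)] xh y by blast
    moreover have "x \<otimes>\<^bsub>R\<^esub> h \<otimes>\<^bsub>R\<^esub> y \<in> I \<cdot>\<^bsub>R\<^esub> J"
      using x y hR I.I_r_closed by (intro ideal_prod.prod) auto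
    ultimately show False using IJ by auto
  qed
qed

section \<open>Additive categories and powers of an endofunctor\<close>

text \<open>The typed associativity law leaves the intermediate objects to be guessed by unification. Stated
  through domains and codomains, it is a rewrite rule whose side conditions the simplifier decides,
  so that composites are brought into right-nested normal form.\<close>

lemma (in category) Comp_Arr:
  assumes "f \<in> Arr C" "g \<in> Arr C" "Cod C f = Dom C g"
  shows "g \<bullet> f \<in> Arr C" "Dom C (g \<bullet> f) = Dom C f" "Cod C (g \<bullet> f) = Cod C g"
  using Comp_homset[of f "Dom C f" "Cod C f" g "Cod C g"] assms by (auto simp: homset_def)

lemma (in category) Comp_assoc_Arr:
  assumes "f \<in> Arr C" "g \<in> Arr C" "h \<in> Arr C" "Cod C f = Dom C g" "Cod C g = Dom C h"
  shows "(h \<bullet> g) \<bullet> f = h \<bullet> (g \<bullet> f)"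
  using Comp_assoc[of f "Dom C f" "Cod C f" g "Cod C g" h "Cod C h"] assms by (auto simp: homset_def)

context preadditive_category
begin

lemma homset_Ob: "f \<in> homset C A B \<Longrightarrow> A \<in> Ob C" "f \<in> homset C A B \<Longrightarrow> B \<in> Ob C"
  using Dom_Ob Cod_Ob by (auto simp: homset_def)

lemma Zero_homset: "\<lbrakk>A \<in> Ob C; B \<in> Ob C\<rbrakk> \<Longrightarrow> Zero C A B \<in> homset C A B"
proof -
  assume "A \<in> Ob C" "B \<in> Ob C"
  then interpret comm_group "hom_group C A B" by (rule hom_comm_group)
  show ?thesis using one_closed by (simp add: hom_group_def)
qed

lemma Comp_Zero_left:
  assumes "f \<in> homset C A B" "D \<in> Ob C"
  shows "Zero C B D \<bullet> f = Zero C A D"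
proof -
  have "(\<lambda>g. g \<bullet> f) \<in> hom (hom_group C B D) (hom_group C A D)"
    using assms by (auto simp: hom_def hom_group_def Comp_Add_left intro: Comp_homset)
  from hom_one[OF this] show ?thesis
    using assms homset_Ob[OF assms(1)] hom_comm_group
    by (simp add: hom_group_def comm_group_def)
qed

lemma Comp_Zero_right:
  assumes "h \<in> homset C B D" "A \<in> Ob C"
  shows "h \<bullet> Zero C A B = Zero C A D"
proof -
  have "(\<lambda>g. h \<bullet> g) \<in> hom (hom_group C A B) (hom_group C A D)"
    using assms by (auto simp: hom_def hom_group_def Comp_Add_right intro: Comp_homset)
  from hom_one[OF this] show ?thesis
    using assms homset_Ob[OF assms(1)] hom_comm_group
    by (simp add: hom_group_def comm_group_def)
qed

lemma zero_object_if_Id_eq_Zero: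
  assumes "A \<in> Ob C" "Id C A = Zero C A A"
  shows "zero_object C A"
  unfolding zero_object_def
proof (intro conjI ballI ex1I)
  fix B assume B: "B \<in> Ob C"
  show "Zero C A B \<in> homset C A B" "Zero C B A \<in> homset C B A"
    using assms B by (simp_all add: Zero_homset)
  show "f = Zero C A B" if "f \<in> homset C A B" for f
    using Id_right[OF that] Comp_Zero_right[OF that assms(1)] assms by simp
  show "f = Zero C B A" if "f \<in> homset C B A" for f
    using Id_left[OF that] Comp_Zero_left[OF that assms(1)] assms by simp
qed (fact assms)

lemma epimorphism_cancel_Zero:
  assumes "epimorphism C f" "f \<in> homset C A B" "g \<in> homset C B D" "g \<bullet> f = Zero C A D"
  shows "g = Zero C B D"
proof -
  have "D \<in> Ob C" using homset_Ob(2)[OF assms(3)] .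
  then have "g \<bullet> f = Zero C B D \<bullet> f" "Zero C B D \<in> homset C B D"
    using assms homset_Ob[OF assms(2)] by (simp_all add: Comp_Zero_left Zero_homset)
  moreover have "Cod C f = B" using assms(2) by (simp add: homset_def)
  ultimately show ?thesis using assms(1,3) unfolding epimorphism_def by blast
qed

end

context additive_endofunctor
begin

abbreviation Fob where "Fob d \<equiv> FOb F ^^ d"
abbreviation Farr where "Farr d \<equiv> FArr F ^^ d"

lemma Fob_Ob: "A \<in> Ob C \<Longrightarrow> Fob d A \<in> Ob C"
  by (induction d) (auto simp: FOb_Ob)

lemma Farr_homset: "f \<in> homset C A B \<Longrightarrow> Farr d f \<in> homset C (Fob d A) (Fob d B)"
  by (induction d) (auto simp: FArr_homset)

lemma Farr_Id: "A \<in> Ob C \<Longrightarrow> Farr d (Id C A) = Id C (Fob d A)"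
  by (induction d) (auto simp: FArr_Id Fob_Ob)

lemma Farr_Comp:
  "\<lbrakk>f \<in> homset C A B; g \<in> homset C B D\<rbrakk> \<Longrightarrow> Farr d (g \<bullet> f) = Farr d g \<bullet> Farr d f"
  by (induction d) (auto simp: FArr_Comp[OF Farr_homset Farr_homset])

lemma Farr_Add:
  "\<lbrakk>f \<in> homset C A B; g \<in> homset C A B\<rbrakk> \<Longrightarrow> Farr d (Add C f g) = Add C (Farr d f) (Farr d g)"
  by (induction d) (auto simp: FArr_Add[OF Farr_homset Farr_homset])

lemma Fob_add: "Fob i (Fob j A) = Fob (i + j) A"
  by (simp add: funpow_add)

lemma Farr_homset_Fob: "f \<in> homset C (Fob j A) B \<Longrightarrow> Farr i f \<in> homset C (Fob (i + j) A) (Fob i B)"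
  using Farr_homset[of f "Fob j A" B i] by (simp add: Fob_add)

lemma Farr_Arr:
  assumes "f \<in> Arr C"
  shows "Farr d f \<in> Arr C" "Dom C (Farr d f) = Fob d (Dom C f)" "Cod C (Farr d f) = Fob d (Cod C f)"
  using Farr_homset[of f "Dom C f" "Cod C f" d] assms by (auto simp: homset_def)

lemma Farr_Comp_Arr:
  assumes "f \<in> Arr C" "g \<in> Arr C" "Cod C f = Dom C g"
  shows "Farr d (g \<bullet> f) = Farr d g \<bullet> Farr d f"
  using Farr_Comp[of f "Dom C f" "Cod C f" g "Cod C g" d] assms by (auto simp: homset_def)

lemma Farr_add: "Farr i (Farr j f) = Farr (i + j) f"
  by (simp add: funpow_add)

definition star where
  "star i f g = f \<bullet> Farr i g"

text \<open>Functoriality enters through associativity: both bracketings of three homogeneous elements equal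
  \<open>x \<bullet> F\<^sup>i y \<bullet> F\<^sup>i\<^sup>+\<^sup>j z\<close>.\<close>

lemma graded_mult_star:
  assumes M: "M \<in> Ob C"
  shows "graded_mult (orbital_hom_group C F M) star (Id C M)"
proof (rule graded_mult.intro)
  fix n
  show "comm_group (orbital_hom_group C F M n)"
    using M by (intro hom_comm_group Fob_Ob)
next
  fix x y i j
  assume xy: "x \<in> carrier (orbital_hom_group C F M i)" "y \<in> carrier (orbital_hom_group C F M j)"
  then show "star i x y \<in> carrier (orbital_hom_group C F M (i + j))"
    by (auto simp: hom_group_def star_def intro: Comp_homset Farr_homset_Fob)
  fix z k assume "z \<in> carrier (orbital_hom_group C F M k)"
  with xy have h: "x \<in> homset C (Fob i M) M" "y \<in> homset C (Fob j M) M" "z \<in> homset C (Fob k M) M"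
    by (auto simp: hom_group_def)
  have "(x \<bullet> Farr i y) \<bullet> Farr (i + j) z = x \<bullet> (Farr i y \<bullet> Farr (i + j) z)"
    using Comp_assoc[OF _ Farr_homset_Fob[OF h(2)] h(1)] Farr_homset[OF h(3)] by blast
  then show "star (i + j) (star i x y) z = star i x (star j y z)"
    using Farr_Comp[OF Farr_homset[OF h(3)] h(2)] by (simp add: star_def funpow_add)
qed (use M in \<open>auto simp: hom_group_def star_def Farr_Add Farr_Id Id_homset Id_left Id_right
      Comp_Add_left[OF Farr_homset_Fob] Comp_Add_right[OF Farr_homset_Fob Farr_homset_Fob]\<close>)

end


section \<open>Orbital rings of decomposed objects\<close>

locale orbital_decomposition = additive_endofunctor C F
  for C :: "('o, 'm, 'x) ab_cat_scheme" (structure) and F :: "('o, 'm) endofun" +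
  fixes M :: 'o and r :: nat and X :: "nat \<Rightarrow> 'o" and \<iota> \<pi> :: "nat \<Rightarrow> 'm"
  assumes direct_sum: "is_direct_sum C {1..r} X M \<iota> \<pi>"
begin

lemma M_Ob: "M \<in> Ob C"
  using direct_sum by (simp add: is_direct_sum_def)

sublocale S: graded_mult "orbital_hom_group C F M" star "Id C M"
  by (rule graded_mult_star[OF M_Ob])

lemma carrier_orbital_hom_group: "carrier (orbital_hom_group C F M d) = homset C (Fob d M) M"
  by (simp add: hom_group_def)

lemma one_orbital_hom_group: "\<one>\<^bsub>orbital_hom_group C F M d\<^esub> = Zero C (Fob d M) M"
  by (simp add: hom_group_def)

lemma orbital_ring_eq: "orbital_ring C F M = S.R"
  unfolding orbital_ring_def convolution_ring_def homogeneous_def star_def Let_def one_orbital_hom_group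
  by (rule refl)

lemma homogeneous_eq: "homogeneous C F M = S.in_degree"
  by (simp add: fun_eq_iff homogeneous_def S.in_degree_def one_orbital_hom_group)

lemma in_summand:
  assumes "i \<in> {1..r}"
  shows "X i \<in> Ob C" "\<iota> i \<in> homset C (X i) M" "\<pi> i \<in> homset C M (X i)" "\<pi> i \<bullet> \<iota> i = Id C (X i)"
  using direct_sum assms by (auto simp: is_direct_sum_def)

lemma summand_Arr:
  assumes "i \<in> {1..r}"
  shows "\<iota> i \<in> Arr C" "Dom C (\<iota> i) = X i" "Cod C (\<iota> i) = M"
    "\<pi> i \<in> Arr C" "Dom C (\<pi> i) = M" "Cod C (\<pi> i) = X i"
  using in_summand[OF assms] by (auto simp: homset_def)

lemmas arr_simps = Comp_Arr Comp_assoc_Arr Farr_Arr Farr_Comp_Arr Farr_add Fob_add summand_Arr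

text \<open>\<open>corner i j d f\<close> is the matrix entry of \<open>f\<close> from \<open>F\<^sup>d (X j)\<close> to \<open>X i\<close>, and \<open>uncorner i j d h\<close> is the
  morphism from \<open>F\<^sup>d M\<close> to \<open>M\<close> whose single nonzero entry is \<open>h\<close>.\<close>

definition corner :: "nat \<Rightarrow> nat \<Rightarrow> nat \<Rightarrow> 'm \<Rightarrow> 'm" where
  "corner i j d f = \<pi> i \<bullet> (f \<bullet> Farr d (\<iota> j))"

definition uncorner :: "nat \<Rightarrow> nat \<Rightarrow> nat \<Rightarrow> 'm \<Rightarrow> 'm" where
  "uncorner i j d h = \<iota> i \<bullet> (h \<bullet> Farr d (\<pi> j))"

lemma corner_homset:
  assumes "i \<in> {1..r}" "j \<in> {1..r}" "f \<in> homset C (Fob d M) M"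
  shows "corner i j d f \<in> homset C (Fob d (X j)) (X i)"
  using assms(3) by (simp add: homset_def corner_def arr_simps assms(1,2) del: atLeastAtMost_iff One_nat_def)

lemma uncorner_homset:
  assumes "i \<in> {1..r}" "j \<in> {1..r}" "h \<in> homset C (Fob d (X j)) (X i)"
  shows "uncorner i j d h \<in> homset C (Fob d M) M"
  using assms(3) by (simp add: homset_def uncorner_def arr_simps assms(1,2) del: atLeastAtMost_iff One_nat_def)

lemma uncorner_corner:
  assumes ij: "i \<in> {1..r}" "j \<in> {1..r}" and f: "f \<in> homset C (Fob d M) M"
    and "(\<iota> i \<bullet> \<pi> i) \<bullet> f = f" "f \<bullet> Farr d (\<iota> j \<bullet> \<pi> j) = f"
  shows "uncorner i j d (corner i j d f) = f"
proof -
  have "uncorner i j d (corner i j d f) = (\<iota> i \<bullet> \<pi> i) \<bullet> (f \<bullet> Farr d (\<iota> j \<bullet> \<pi> j))"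
    using f by (simp add: homset_def corner_def uncorner_def arr_simps ij del: atLeastAtMost_iff One_nat_def)
  with assms show ?thesis by simp
qed

lemma corner_uncorner:
  assumes ij: "i \<in> {1..r}" "j \<in> {1..r}" and h: "h \<in> homset C (Fob d (X j)) (X i)"
  shows "corner i j d (uncorner i j d h) = h"
proof -
  have "corner i j d (uncorner i j d h) = (\<pi> i \<bullet> \<iota> i) \<bullet> (h \<bullet> Farr d (\<pi> j \<bullet> \<iota> j))"
    using h by (simp add: homset_def corner_def uncorner_def arr_simps ij del: atLeastAtMost_iff One_nat_def)
  also have "\<dots> = h"
    using h by (simp add: in_summand ij Farr_Id Id_left[OF h] Id_right[OF h] del: atLeastAtMost_iff One_nat_def)
  finally show ?thesis .
qed

lemma uncorner_absorb:
  assumes ij: "i \<in> {1..r}" "j \<in> {1..r}" and h: "h \<in> homset C (Fob d (X j)) (X i)"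
  shows "(\<iota> i \<bullet> \<pi> i) \<bullet> uncorner i j d h = uncorner i j d h"
    and "uncorner i j d h \<bullet> Farr d (\<iota> j \<bullet> \<pi> j) = uncorner i j d h"
proof -
  have "(\<iota> i \<bullet> \<pi> i) \<bullet> uncorner i j d h = \<iota> i \<bullet> (((\<pi> i \<bullet> \<iota> i) \<bullet> h) \<bullet> Farr d (\<pi> j))"
    using h by (simp add: homset_def uncorner_def arr_simps ij del: atLeastAtMost_iff One_nat_def)
  then show "(\<iota> i \<bullet> \<pi> i) \<bullet> uncorner i j d h = uncorner i j d h"
    by (simp add: in_summand ij Id_left[OF h] uncorner_def del: atLeastAtMost_iff One_nat_def)
  have "uncorner i j d h \<bullet> Farr d (\<iota> j \<bullet> \<pi> j) = \<iota> i \<bullet> ((h \<bullet> Farr d (\<pi> j \<bullet> \<iota> j)) \<bullet> Farr d (\<pi> j))"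
    using h by (simp add: homset_def uncorner_def arr_simps ij del: atLeastAtMost_iff One_nat_def)
  then show "uncorner i j d h \<bullet> Farr d (\<iota> j \<bullet> \<pi> j) = uncorner i j d h"
    by (simp add: in_summand ij Farr_Id Id_right[OF h] uncorner_def del: atLeastAtMost_iff One_nat_def)
qed

text \<open>The general entry of a product is a sum over the middle index; as \<open>f\<close> is absorbed by the \<open>j\<close>-th
  idempotent, only the \<open>j\<close>-th summand is left.\<close>

lemma corner_Comp:
  assumes ijl: "i \<in> {1..r}" "j \<in> {1..r}" "l \<in> {1..r}"
    and f: "f \<in> homset C (Fob m M) M" and g: "g \<in> homset C (Fob n M) M"
    and fj: "f \<bullet> Farr m (\<iota> j \<bullet> \<pi> j) = f"
  shows "corner i j m f \<bullet> Farr m (corner j l n g) = corner i l (m + n) (f \<bullet> Farr m g)"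
proof -
  have "corner i j m f \<bullet> Farr m (corner j l n g)
      = \<pi> i \<bullet> (((f \<bullet> Farr m (\<iota> j \<bullet> \<pi> j)) \<bullet> Farr m g) \<bullet> Farr (m + n) (\<iota> l))"
    using f g by (simp add: homset_def corner_def arr_simps ijl del: atLeastAtMost_iff One_nat_def)
  then show ?thesis by (simp add: fj corner_def)
qed

lemma corner_Zero:
  assumes ij: "i \<in> {1..r}" "j \<in> {1..r}"
  shows "corner i j d (Zero C (Fob d M) M) = Zero C (Fob d (X j)) (X i)"
  using Comp_Zero_left[OF Farr_homset[OF in_summand(2)[OF ij(2)]] M_Ob, of d]
    Comp_Zero_right[OF in_summand(3)[OF ij(1)] Fob_Ob[OF in_summand(1)[OF ij(2)]], of d]
  by (simp add: corner_def)

lemma uncorner_Zero: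
  assumes ij: "i \<in> {1..r}" "j \<in> {1..r}"
  shows "uncorner i j d (Zero C (Fob d (X j)) (X i)) = Zero C (Fob d M) M"
  using Comp_Zero_left[OF Farr_homset[OF in_summand(3)[OF ij(2)]] in_summand(1)[OF ij(1)], of d]
    Comp_Zero_right[OF in_summand(2)[OF ij(1)] Fob_Ob[OF M_Ob], of d]
  by (simp add: uncorner_def)

abbreviation \<epsilon> where "\<epsilon> k \<equiv> \<iota> k \<bullet> \<pi> k"

lemma idempotent_homset: "i \<in> {1..r} \<Longrightarrow> \<epsilon> i \<in> homset C M M"
  using in_summand Comp_homset by blast

lemma idempotent_mult:
  assumes ij: "i \<in> {1..r}" "j \<in> {1..r}"
  shows "\<epsilon> i \<bullet> \<epsilon> j = (if i = j then \<epsilon> i else Zero C M M)"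
proof -
  have eq: "\<epsilon> i \<bullet> \<epsilon> j = \<iota> i \<bullet> ((\<pi> i \<bullet> \<iota> j) \<bullet> \<pi> j)"
    by (simp add: arr_simps ij del: atLeastAtMost_iff One_nat_def)
  show ?thesis
  proof (cases "i = j")
    case True
    then show ?thesis
      using eq Id_left[OF in_summand(3)[OF ij(2)]] in_summand(4)[OF ij(2)] by simp
  next
    case False
    then have "\<pi> i \<bullet> \<iota> j = Zero C (X j) (X i)"
      using direct_sum ij unfolding is_direct_sum_def by metis
    then show ?thesis
      using eq False Comp_Zero_left[OF in_summand(3)[OF ij(2)] in_summand(1)[OF ij(1)]]
        Comp_Zero_right[OF in_summand(2)[OF ij(1)] M_Ob] by simp
  qed
qed

text \<open>The entry of \<open>g\<close>, if nonzero, is an epimorphism that stays one under the power of \<open>F\<close> by which it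
  is composed with the entry of \<open>f\<close>; cancelling it shows that the entry of \<open>f\<close> vanishes.\<close>

lemma piecewise_domain_orbital_ring:
  assumes epi: "\<And>d j l f. \<lbrakk>j \<in> {1..r}; l \<in> {1..r}; f \<in> homset C (Fob d (X j)) (X l);
        f \<noteq> Zero C (Fob d (X j)) (X l)\<rbrakk> \<Longrightarrow> epimorphism C f"
    and epi_F: "\<And>e j l g d. \<lbrakk>j \<in> {1..r}; l \<in> {1..r}; g \<in> homset C (Fob e (X j)) (X l);
        epimorphism C g\<rbrakk> \<Longrightarrow> epimorphism C (Farr d g)"
  shows "piecewise_domain (orbital_ring C F M) r (\<lambda>k. homogeneous C F M 0 (\<epsilon> k))"
  unfolding orbital_ring_eq homogeneous_eq
proof (rule S.piecewise_domain_R, unfold carrier_orbital_hom_group one_orbital_hom_group)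
  show "\<epsilon> i \<in> homset C (Fob 0 M) M" if "i \<in> {1..r}" for i
    using idempotent_homset[OF that] by simp
  show "star 0 (\<epsilon> i) (\<epsilon> i) = \<epsilon> i" if "i \<in> {1..r}" for i
    using idempotent_mult[OF that that] by (simp add: star_def)
  show "star 0 (\<epsilon> i) (\<epsilon> j) = Zero C (Fob 0 M) M" if "i \<in> {1..r}" "j \<in> {1..r}" "i \<noteq> j" for i j
    using idempotent_mult[OF that(1,2)] that(3) by (simp add: star_def)
  show "finprod (orbital_hom_group C F M 0) \<epsilon> {1..r} = Id C M"
    using direct_sum by (simp add: is_direct_sum_def)
  fix i j l m n f g
  assume ijl: "i \<in> {1..r}" "j \<in> {1..r}" "l \<in> {1..r}"
    and f: "f \<in> homset C (Fob m M) M" "star 0 (\<epsilon> i) f = f" "star m f (\<epsilon> j) = f"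
    and g: "g \<in> homset C (Fob n M) M" "star 0 (\<epsilon> j) g = g" "star n g (\<epsilon> l) = g"
    and fg: "star m f g = Zero C (Fob (m + n) M) M"
  define f' where "f' = corner i j m f"
  define g' where "g' = corner j l n g"
  have f': "f' \<in> homset C (Fob m (X j)) (X i)" "uncorner i j m f' = f"
    using f ijl by (simp_all add: f'_def corner_homset uncorner_corner star_def del: atLeastAtMost_iff One_nat_def)
  have g': "g' \<in> homset C (Fob n (X l)) (X j)" "uncorner j l n g' = g"
    using g ijl by (simp_all add: g'_def corner_homset uncorner_corner star_def del: atLeastAtMost_iff One_nat_def)
  have fg': "f' \<bullet> Farr m g' = Zero C (Fob (m + n) (X l)) (X i)"
    using corner_Comp[OF ijl f(1) g(1)] f fg corner_Zero[OF ijl(1,3)]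
    by (simp add: f'_def g'_def star_def)
  have "f' = Zero C (Fob m (X j)) (X i)" if "g' \<noteq> Zero C (Fob n (X l)) (X j)"
  proof -
    have "epimorphism C (Farr m g')"
      using epi[OF ijl(3,2) g'(1) that] epi_F[OF ijl(3,2) g'(1)] by blast
    from epimorphism_cancel_Zero[OF this Farr_homset_Fob[OF g'(1)] f'(1) fg'] show ?thesis .
  qed
  then show "f = Zero C (Fob m M) M \<or> g = Zero C (Fob n M) M"
    using f'(2) g'(2) uncorner_Zero ijl by metis
qed

text \<open>A nonzero morphism between summands, extended by zero to \<open>F\<^sup>d M\<close> and placed in degree \<open>d\<close>, is a
  nonzero element of the corner.\<close>

lemma peirce_nonzero_orbital_ring:
  assumes ij: "i \<in> {1..r}" "j \<in> {1..r}"
    and h: "h \<in> homset C (Fob d (X j)) (X i)" "h \<noteq> Zero C (Fob d (X j)) (X i)"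
  shows "\<exists>x \<in> peirce (orbital_ring C F M) (homogeneous C F M 0 (\<epsilon> i)) (homogeneous C F M 0 (\<epsilon> j)).
    x \<noteq> \<zero>\<^bsub>orbital_ring C F M\<^esub>"
  unfolding orbital_ring_eq homogeneous_eq
proof (rule bexI)
  let ?x = "uncorner i j d h"
  have x: "?x \<in> carrier (orbital_hom_group C F M d)"
    using uncorner_homset[OF ij h(1)] by (simp add: carrier_orbital_hom_group)
  have e: "\<epsilon> i \<in> carrier (orbital_hom_group C F M 0)" "star 0 (\<epsilon> i) (\<epsilon> i) = \<epsilon> i" if "i \<in> {1..r}" for i
    using idempotent_mult[OF that that] idempotent_homset[OF that]
    by (simp_all add: hom_group_def star_def)
  have "?x \<noteq> Zero C (Fob d M) M"
    using corner_uncorner[OF ij h(1)] corner_Zero[OF ij] h(2) by metis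
  then show "S.in_degree d ?x \<noteq> \<zero>\<^bsub>S.R\<^esub>"
    by (simp add: S.in_degree_eq_zero_iff one_orbital_hom_group)
  have "star 0 (\<epsilon> i) (S.in_degree d ?x n) = S.in_degree d ?x n \<and>
      star n (S.in_degree d ?x n) (\<epsilon> j) = S.in_degree d ?x n" for n
    using uncorner_absorb[OF ij h(1)] S.p_zero_right[OF e(1)[OF ij(1)], of n]
      S.p_zero_left[OF e(1)[OF ij(2)], of n]
    by (auto simp: S.in_degree_def star_def)
  then show "S.in_degree d ?x \<in> peirce S.R (S.in_degree 0 (\<epsilon> i)) (S.in_degree 0 (\<epsilon> j))"
    using S.peirce_in_degree_iff[OF e[OF ij(1)] e[OF ij(2)]] S.in_degree_closed[OF x] by blast
qed

lemma one_neq_zero_orbital_ring: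
  assumes "\<not> zero_object C M"
  shows "\<one>\<^bsub>orbital_ring C F M\<^esub> \<noteq> \<zero>\<^bsub>orbital_ring C F M\<^esub>"
  using assms zero_object_if_Id_eq_Zero[OF M_Ob]
  by (auto simp: orbital_ring_eq S.one_eq S.in_degree_eq_zero_iff one_orbital_hom_group[of 0, simplified])

end

theorem theorem2p6:
  fixes C :: "('o, 'm, 'x) ab_cat_scheme"
    and F :: "('o, 'm) endofun"
    and M :: 'o
    and r :: nat
    and X :: "nat \<Rightarrow> 'o"
    and \<iota> \<pi> :: "nat \<Rightarrow> 'm"
  assumes "additive_category C"
    and "additive_endofunctor C F"
    and "M \<in> Ob C"
    and "\<not> zero_object C M"
    and "is_direct_sum C {1..r} X M \<iota> \<pi>"
    and i: "\<forall>d. \<forall>j \<in> {1..r}. \<forall>l \<in> {1..r}. \<forall>f \<in> homset C ((FOb F ^^ d) (X j)) (X l).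
              f \<noteq> Zero C ((FOb F ^^ d) (X j)) (X l) \<longrightarrow> epimorphism C f"
    and ii: "\<forall>e. \<forall>j \<in> {1..r}. \<forall>l \<in> {1..r}. \<forall>g \<in> homset C ((FOb F ^^ e) (X j)) (X l).
              epimorphism C g \<longrightarrow> (\<forall>d. epimorphism C ((FArr F ^^ d) g))"
  shows "piecewise_domain (orbital_ring C F M) r
           (\<lambda>k. homogeneous C F M 0 (\<iota> k \<bullet>\<^bsub>C\<^esub> \<pi> k)) \<and>
         ((\<forall>j \<in> {1..r}. \<forall>l \<in> {1..r}. j \<noteq> l \<longrightarrow>
             (\<exists>i. \<exists>h \<in> homset C ((FOb F ^^ i) (X j)) (X l).
                h \<noteq> Zero C ((FOb F ^^ i) (X j)) (X l)))
          \<longrightarrow> prime_ring (orbital_ring C F M))"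
proof -
  interpret additive_endofunctor C F by fact
  interpret orbital_decomposition C F M r X \<iota> \<pi> by unfold_locales fact
  have pd: "piecewise_domain (orbital_ring C F M) r (\<lambda>k. homogeneous C F M 0 (\<epsilon> k))"
    using i ii by (intro piecewise_domain_orbital_ring) blast+
  moreover have "prime_ring (orbital_ring C F M)"
    if iii: "\<forall>j \<in> {1..r}. \<forall>l \<in> {1..r}. j \<noteq> l \<longrightarrow>
        (\<exists>i. \<exists>h \<in> homset C (Fob i (X j)) (X l). h \<noteq> Zero C (Fob i (X j)) (X l))"
  proof (rule prime_ring_if_piecewise_domain[OF pd])
    show "\<one>\<^bsub>orbital_ring C F M\<^esub> \<noteq> \<zero>\<^bsub>orbital_ring C F M\<^esub>"
      by (rule one_neq_zero_orbital_ring) fact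
    fix j l assume jl: "j \<in> {1..r}" "l \<in> {1..r}" "j \<noteq> l"
    \<comment> \<open>The corner of \<open>\<epsilon> j\<close> and \<open>\<epsilon> l\<close> consists of morphisms into \<open>X j\<close>, hence the exchange of indices.\<close>
    then obtain d h where "h \<in> homset C (Fob d (X l)) (X j)" "h \<noteq> Zero C (Fob d (X l)) (X j)"
      using iii by metis
    then show "\<exists>x \<in> peirce (orbital_ring C F M) (homogeneous C F M 0 (\<epsilon> j)) (homogeneous C F M 0 (\<epsilon> l)).
        x \<noteq> \<zero>\<^bsub>orbital_ring C F M\<^esub>"
      by (rule peirce_nonzero_orbital_ring[OF jl(1,2)])
  qed
  ultimately show ?thesis by blast
qed

end
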